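(* The complete feather $F$ is not strongly contractible to any of its points; that is, there is no point $p\in F$ such that $F$ is strongly contractible to $p$.
   Context: The complete feather $F$ is the following topological space. Its underlying set is the set of all finite sequences $s=(s_0,\dots,s_n)$, for some $n\ge 0$, with $s_i\in\mathbb{R}$ and $s_0<s_1<\dots<s_{n-1}\le s_n$ (the last inequality is not strict, all the others are; for $n=0$ there is no condition on $s_0$). It carries the partial order defined by $(s_0,\dots,s_n)<(t_0,\dots,t_m)$ if and only if $n\le m$, $s_i=t_i$ for $i=0,\dots,n-1$, and $s_n<t_n$. $F$ is given the order topology of this partial order, i.e. the topology having as a base the open intervals $\{x\in F: a<x<b\}$ with $a,b\in F$, $a<b$. A space $X$ is strongly contractible to the point $p\in X$ if there exists a homotopy $h_t:X\to X$, $t\in[0,1]$ (jointly continuous in $(x,t)$), such that $h_0=\mathrm{id}$, $h_1\equiv p$, and $h_t(p)=p$ for all $t$. *)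

theory Defs
  imports "HOL-Analysis.Analysis"
begin

text \<open>The sequence \<open>(s\<^sub>0, \<dots>, s\<^sub>n)\<close> is a list of length \<open>n + 1\<close>, so \<open>n = length s - 1\<close>.\<close>

definition feather :: "real list set" where
  "feather = {s. s \<noteq> [] \<and>
     (\<forall>i. Suc i < length s - 1 \<longrightarrow> s ! i < s ! Suc i) \<and>
     (length s \<ge> 2 \<longrightarrow> s ! (length s - 2) \<le> s ! (length s - 1))}"

definition feather_less :: "real list \<Rightarrow> real list \<Rightarrow> bool" where
  "feather_less s t \<longleftrightarrow> length s \<le> length t \<and>
     (\<forall>i < length s - 1. s ! i = t ! i) \<and>
     s ! (length s - 1) < t ! (length s - 1)"

definition feather_interval :: "real list \<Rightarrow> real list \<Rightarrow> real list set" where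
  "feather_interval a b = {x \<in> feather. feather_less a x \<and> feather_less x b}"

definition feather_basic :: "real list set \<Rightarrow> bool" where
  "feather_basic U \<longleftrightarrow> (\<exists>a\<in>feather. \<exists>b\<in>feather. feather_less a b \<and> U = feather_interval a b)"

definition feather_topology :: "real list topology" where
  "feather_topology = topology (arbitrary union_of feather_basic)"

definition strongly_contractible_to :: "'a topology \<Rightarrow> 'a \<Rightarrow> bool" where
  "strongly_contractible_to X p \<longleftrightarrow> p \<in> topspace X \<and>
     (\<exists>h. continuous_map (prod_topology X (top_of_set {0..1::real})) X h \<and>
          (\<forall>x \<in> topspace X. h (x, 0) = x) \<and>
          (\<forall>x \<in> topspace X. h (x, 1) = p) \<and>
          (\<forall>t \<in> {0..1}. h (p, t) = p))"

lemma feather_less_irrefl: "\<not> feather_less s s"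
  by (simp add: feather_less_def)

lemma feather_less_trans:
  assumes "s \<in> feather" "t \<in> feather" "feather_less s t" "feather_less t u"
  shows "feather_less s u"
proof -
  have "length s > 0" "length t > 0"
    using assms by (auto simp: feather_def)
  then have prefix: "\<forall>i < length s - 1. s ! i = u ! i"
    using assms by (auto simp: feather_less_def)
  have "t ! (length s - 1) \<le> u ! (length s - 1)"
  proof (cases "length s = length t")
    case True
    then show ?thesis using assms by (auto simp: feather_less_def)
  next
    case False
    then have "length s - 1 < length t - 1"
      using assms(3) \<open>length s > 0\<close> unfolding feather_less_def by linarith
    then show ?thesis using assms(4) by (auto simp: feather_less_def)
  qed
  then show ?thesis
    using assms prefix by (auto simp: feather_less_def)
qed

lemma feather_less_chain_below:
  assumes "a \<in> feather" "c \<in> feather" "feather_less a x" "feather_less c x"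
  shows "a = c \<or> feather_less a c \<or> feather_less c a"
proof -
  have pos: "length a > 0" "length c > 0"
    using assms by (auto simp: feather_def)
  consider "length a < length c" | "length c < length a" | "length a = length c"
    by linarith
  then show ?thesis
  proof cases
    case 1
    then have "length a - 1 < length c - 1" using pos by linarith
    then show ?thesis using assms 1 by (auto simp: feather_less_def)
  next
    case 2
    then have "length c - 1 < length a - 1" using pos by linarith
    then show ?thesis using assms 2 by (auto simp: feather_less_def)
  next
    case 3
    have eq: "\<forall>i < length a - 1. a ! i = c ! i"
      using assms 3 by (auto simp: feather_less_def)
    consider "a ! (length a - 1) < c ! (length a - 1)" | "c ! (length a - 1) < a ! (length a - 1)"
      | "a ! (length a - 1) = c ! (length a - 1)"
      by linarith
    then show ?thesis
    proof cases
      case 3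
      have "a ! i = c ! i" if "i < length a" for i
      proof (cases "i = length a - 1")
        case False
        then have "i < length a - 1" using that by linarith
        then show ?thesis using eq by blast
      qed (use 3 in simp)
      then show ?thesis
        using \<open>length a = length c\<close> by (auto intro: nth_equalityI)
    qed (use 3 eq in \<open>auto simp: feather_less_def\<close>)
  qed
qed

lemma feather_less_common_bound:
  assumes x: "x \<in> feather" and "b \<in> feather" "d \<in> feather" "feather_less x b" "feather_less x d"
  obtains e where "e \<in> feather" "feather_less x e"
    "\<And>y. y \<in> feather \<Longrightarrow> feather_less y e \<Longrightarrow> feather_less y b \<and> feather_less y d"
proof -
  define n where "n = length x - 1"
  define e where "e = x[n := min (b ! n) (d ! n)]"
  have len: "length x = Suc n"
    using x by (auto simp: feather_def n_def)
  have e_nth: "e ! i = (if i = n then min (b ! n) (d ! n) else x ! i)" if "i \<le> n" for i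
    using that len by (simp add: e_def nth_list_update)
  have len_e: "length e = Suc n"
    by (simp add: e_def len)
  have b: "n < length b" "\<forall>i<n. x ! i = b ! i" "x ! n < b ! n"
    and d: "n < length d" "\<forall>i<n. x ! i = d ! i" "x ! n < d ! n"
    using assms len by (auto simp: feather_less_def)
  have xe: "feather_less x e"
    using b d by (auto simp: feather_less_def len len_e e_nth)
  have "e \<noteq> []"
    using len_e by auto
  moreover have "\<forall>i. Suc i < n \<longrightarrow> e ! i < e ! Suc i"
    using x by (simp add: feather_def len e_nth)
  moreover have "e ! (n - 1) \<le> e ! n" if "n \<ge> 1"
  proof -
    have "x ! (n - 1) \<le> x ! n"
      using x that by (simp add: feather_def len)
    then show ?thesis
      using that b d by (simp add: e_nth)
  qed
  ultimately have "e \<in> feather"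
    by (simp add: feather_def len_e)
  moreover have "feather_less y b \<and> feather_less y d" if "y \<in> feather" "feather_less y e" for y
  proof -
    define k where "k = length y - 1"
    have len_y: "length y = Suc k"
      using that by (auto simp: feather_def k_def)
    have "k \<le> n" "\<forall>i<k. y ! i = e ! i" "y ! k < e ! k"
      using that by (auto simp: feather_less_def len_e len_y)
    then show ?thesis
      using b d by (cases "k = n") (auto simp: feather_less_def len_y e_nth)
  qed
  ultimately show ?thesis
    using that xe by blast
qed

text \<open>The open intervals form a base, so \<^const>\<open>feather_topology\<close> is not a junk value.\<close>

lemma istopology_feather: "istopology (arbitrary union_of feather_basic)"
  unfolding istopology_base_eq
proof (intro allI impI, elim conjE)
  fix S T assume "feather_basic S" "feather_basic T"
  then obtain a b c d where ab: "a \<in> feather" "b \<in> feather" "S = feather_interval a b"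
    and cd: "c \<in> feather" "d \<in> feather" "T = feather_interval c d"
    unfolding feather_basic_def by blast
  have "\<exists>U. feather_basic U \<and> x \<in> U \<and> U \<subseteq> S \<inter> T" if "x \<in> S \<inter> T" for x
  proof -
    have x: "x \<in> feather" "feather_less a x" "feather_less x b" "feather_less c x" "feather_less x d"
      using that ab cd by (auto simp: feather_interval_def)
    obtain m where m: "m \<in> feather" "feather_less m x"
      "\<And>y. feather_less m y \<Longrightarrow> feather_less a y \<and> feather_less c y"
    proof -
      consider "a = c" | "feather_less a c" | "feather_less c a"
        using feather_less_chain_below[OF ab(1) cd(1) x(2) x(4)] by blast
      then show thesis
      proof cases
        case 1
        then show thesis using that[of a] ab(1) x(2) by blast
      next
        case 2
        then show thesis using that[of c] feather_less_trans[OF ab(1) cd(1) 2] cd(1) x(4) by blast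
      next
        case 3
        then show thesis using that[of a] feather_less_trans[OF cd(1) ab(1) 3] ab(1) x(2) by blast
      qed
    qed
    obtain e where e: "e \<in> feather" "feather_less x e"
      "\<And>y. y \<in> feather \<Longrightarrow> feather_less y e \<Longrightarrow> feather_less y b \<and> feather_less y d"
      using feather_less_common_bound[OF x(1) ab(2) cd(2) x(3) x(5)] by blast
    have "feather_basic (feather_interval m e)"
      unfolding feather_basic_def using m(1) e(1) feather_less_trans[OF m(1) x(1) m(2) e(2)] by blast
    moreover have "x \<in> feather_interval m e" "feather_interval m e \<subseteq> S \<inter> T"
      using x m e ab cd by (auto simp: feather_interval_def)
    ultimately show ?thesis by blast
  qed
  then show "(arbitrary union_of feather_basic) (S \<inter> T)"
    by (simp add: arbitrary_union_of_alt)
qed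

lemma openin_feather_topology: "openin feather_topology = arbitrary union_of feather_basic"
  by (simp add: feather_topology_def istopology_feather)

lemma topspace_feather_topology: "topspace feather_topology = feather"
proof
  show "topspace feather_topology \<subseteq> feather"
    unfolding topspace_def openin_feather_topology
    by (auto simp: union_of_def feather_basic_def feather_interval_def)
  show "feather \<subseteq> topspace feather_topology"
  proof
    fix x assume x: "x \<in> feather"
    define n where "n = length x - 1"
    have len: "length x = Suc n"
      using x by (auto simp: feather_def n_def)
    define a where "a = [x ! 0 - 1]"
    define b where "b = x[n := x ! n + 1]"
    have "a \<in> feather"
      by (simp add: feather_def a_def)
    moreover have "b \<in> feather"
      using x by (force simp: feather_def b_def len nth_list_update)
    moreover have "feather_less a x" "feather_less x b"
      using len by (auto simp: feather_less_def a_def b_def)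
    ultimately have "feather_basic (feather_interval a b)" "x \<in> feather_interval a b"
      using x feather_less_trans[of a x b] by (auto simp: feather_basic_def feather_interval_def)
    then show "x \<in> topspace feather_topology"
      unfolding topspace_def openin_feather_topology arbitrary_union_of_alt by blast
  qed
qed

end

theory Submission
  imports Defs
begin

text \<open>
  Every \<open>p \<in> F\<close> has a twin \<open>q \<noteq> p\<close> that cannot be separated from it by disjoint open sets:
  \<open>(s\<^sub>0, \<dots>, s\<^sub>n)\<close> and \<open>(s\<^sub>0, \<dots>, s\<^sub>n, s\<^sub>n)\<close> are twins when \<open>s\<close> is strictly increasing.
  If \<open>h\<close> is a homotopy fixing \<open>p\<close>, then \<open>h\<^sub>t(q)\<close> stays inseparable from \<open>h\<^sub>t(p) = p\<close>, so the
  last coordinate, being continuous and real-valued, is constant along the path \<open>t \<mapsto> h\<^sub>t(q)\<close>.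
  The last coordinate is also locally injective, so this path is constant and never reaches \<open>p\<close>.
\<close>

section \<open>Shape of the points, and the order seen through the last coordinate\<close>

lemma feather_append_iff:
  "u @ [l] \<in> feather \<longleftrightarrow> sorted_wrt (<) u \<and> (\<forall>x\<in>set u. x \<le> l)"
proof (cases u rule: rev_cases)
  case Nil
  then show ?thesis by (simp add: feather_def)
next
  case (snoc v k)
  have "(\<forall>i. Suc i < length u \<longrightarrow> (u @ [l]) ! i < (u @ [l]) ! Suc i) \<longleftrightarrow> sorted_wrt (<) u"
    by (auto simp: sorted_wrt_iff_nth_Suc_transp nth_append)
  moreover have "(u @ [l]) ! (length (u @ [l]) - 2) = k"
    using snoc by (simp add: nth_append)
  ultimately have "u @ [l] \<in> feather \<longleftrightarrow> sorted_wrt (<) u \<and> k \<le> l"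
    using snoc by (simp add: feather_def nth_append)
  also have "\<dots> \<longleftrightarrow> sorted_wrt (<) u \<and> (\<forall>x\<in>set u. x \<le> l)"
    using snoc by (auto simp: sorted_wrt_append)
  finally show ?thesis .
qed

lemma feather_cases:
  assumes "s \<in> feather"
  obtains u l where "s = u @ [l]" "sorted_wrt (<) u" "\<forall>x\<in>set u. x \<le> l"
proof (cases s rule: rev_cases)
  case Nil
  then show thesis using assms by (simp add: feather_def)
next
  case (snoc u l)
  then show thesis using assms that feather_append_iff by blast
qed

text \<open>Sorts the points into twin pairs. If the last entry \<open>l\<close> already occurs in
  the strictly increasing stem, it is bounded by the stem's final entry, which is itself at most
  \<open>l\<close>; so that final entry is \<open>l\<close>.\<close>

lemma feather_strict_cases:
  assumes "s \<in> feather"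
  obtains v l where "sorted_wrt (<) (v @ [l])" "s = v @ [l] \<or> s = v @ [l, l]"
proof -
  obtain u l where s: "s = u @ [l]" and u: "sorted_wrt (<) u" "\<forall>x\<in>set u. x \<le> l"
    using assms by (rule feather_cases)
  show thesis
  proof (cases "\<forall>x\<in>set u. x < l")
    case True
    then show thesis using that[of u l] u s by (auto simp: sorted_wrt_append)
  next
    case False
    then have "l \<in> set u" using u(2) by (metis order_le_imp_less_or_eq)
    then obtain v k where "u = v @ [k]" by (cases u rule: rev_cases) auto
    moreover from this have "k = l"
      using u \<open>l \<in> set u\<close> by (force simp: sorted_wrt_append)
    ultimately show thesis using that[of v l] u s by auto
  qed
qed

text \<open>Only the entry of \<open>t\<close> at position \<open>length u\<close> is compared with
  \<open>l\<close>; whatever follows it is free. This form replaces index arithmetic by list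
  patterns.\<close>

lemma feather_less_append_iff:
  "feather_less (u @ [l]) t \<longleftrightarrow> (\<exists>m w. t = u @ m # w \<and> l < m)"
proof
  assume "feather_less (u @ [l]) t"
  then have t: "length u < length t" "\<forall>i<length u. u ! i = t ! i" "l < t ! length u"
    by (auto simp: feather_less_def nth_append)
  then have "take (length u) t = u"
    by (auto intro: nth_equalityI)
  then show "\<exists>m w. t = u @ m # w \<and> l < m"
    using t id_take_nth_drop[of "length u" t] by auto
qed (auto simp: feather_less_def nth_append)

text \<open>The first entry that differs already exceeds \<open>last s\<close>, and no later entry
  of \<open>t\<close> falls below it.\<close>

lemma feather_less_last:
  assumes "s \<in> feather" "t \<in> feather" "feather_less s t"
  shows "last s < last t"
proof -
  obtain u l where s: "s = u @ [l]" using assms(1) by (rule feather_cases)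
  then obtain m w where t: "t = u @ m # w" "l < m"
    using assms(3) feather_less_append_iff by auto
  show ?thesis
  proof (cases w rule: rev_cases)
    case (snoc w' k)
    then have "(u @ m # w') @ [k] \<in> feather" using assms(2) t by simp
    then have "m \<le> k" unfolding feather_append_iff by simp
    then show ?thesis using s t snoc by simp
  qed (use s t in simp)
qed

text \<open>The points below a common bound form a chain, and \<open>last\<close> is strictly
  increasing along it. Basic intervals are bounded above, so \<open>last\<close> is locally
  injective.\<close>

lemma feather_last_inj_below:
  assumes "x \<in> feather" "y \<in> feather" "feather_less x b" "feather_less y b" "last x = last y"
  shows "x = y"
  using feather_less_chain_below[OF assms(1-4)] feather_less_last[OF assms(1,2)]
    feather_less_last[OF assms(2,1)] assms(5) by auto

section \<open>Small intervals and continuity of the last coordinate\<close>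

lemma dense_above_finite:
  fixes l :: "'a :: {linorder, dense_order}"
  assumes "finite A" "\<forall>x\<in>A. x < l" "A \<noteq> {}"
  shows "\<exists>y<l. \<forall>x\<in>A. x < y"
  using dense[of "Max A" l] assms by auto

lemma feather_interval_around:
  assumes "x \<in> feather" "c < last x" "last x < d"
  obtains a b where "a \<in> feather" "b \<in> feather" "x \<in> feather_interval a b"
    "c < last a" "last b < d"
proof -
  obtain v l where v: "sorted_wrt (<) (v @ [l])" and x: "x = v @ [l] \<or> x = v @ [l, l]"
    using assms(1) by (rule feather_strict_cases)
  have l: "last x = l" using x by auto
  obtain y where y: "y < l" "c < y" "\<forall>z\<in>set v. z < y"
    using dense_above_finite[of "insert c (set v)" l] v assms(2) l
    by (auto simp: sorted_wrt_append)
  obtain u where u: "x = u @ [l]" "sorted_wrt (<) u" "\<forall>z\<in>set u. z \<le> l"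
    using assms(1) l by (metis feather_cases last_snoc)
  obtain m where m: "l < m" "m < d" using dense assms(3) l by blast
  show thesis
  proof
    \<comment> \<open>The lower endpoint grows from the stem \<open>v\<close> without the repeated
      entry: for \<open>x = v @ [l, l]\<close>, lowering the final entry in place would leave
      \<open>feather\<close>. Raising it is always allowed, so the upper endpoint keeps the length
      of \<open>x\<close>.\<close>
    show "v @ [y] \<in> feather"
      using v y by (auto simp: feather_append_iff sorted_wrt_append)
    show "u @ [m] \<in> feather"
      using u m by (auto simp: feather_append_iff)
    show "x \<in> feather_interval (v @ [y]) (u @ [m])"
      using x y m assms(1) u(1) by (auto simp: feather_interval_def feather_less_append_iff)
  qed (use y m in auto)
qed

lemma openin_feather_interval:
  assumes "a \<in> feather" "b \<in> feather"
  shows "openin feather_topology (feather_interval a b)"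
\<comment> \<open>\<open>feather_basic\<close> demands \<open>feather_less a b\<close>; any point in
  between supplies it by transitivity.\<close>
proof (cases "feather_interval a b = {}")
  case False
  then have "feather_less a b"
    using feather_less_trans[OF assms(1)] by (auto simp: feather_interval_def)
  then have "feather_basic (feather_interval a b)"
    using assms by (auto simp: feather_basic_def)
  then show ?thesis
    by (simp add: openin_feather_topology arbitrary_union_of_inc)
qed simp

lemma openin_feather_imp_interval:
  assumes "openin feather_topology U" "x \<in> U"
  obtains a b where "a \<in> feather" "b \<in> feather" "x \<in> feather_interval a b" "feather_interval a b \<subseteq> U"
  using assms unfolding openin_feather_topology arbitrary_union_of_alt feather_basic_def by blast

text \<open>Since \<open>last\<close> is strictly monotone, an interval whose relevant endpoint has
  last coordinate beyond \<open>c\<close> stays on that side of \<open>c\<close>.\<close>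

lemma continuous_map_feather_last: "continuous_map feather_topology euclideanreal last"
  unfolding continuous_map_upper_lower_semicontinuous_lt topspace_feather_topology
proof (intro conjI allI)
  fix c :: real
  show "openin feather_topology {x \<in> feather. c < last x}"
  proof (subst openin_subopen, clarify)
    fix x :: "real list" assume x: "x \<in> feather" "c < last x"
    \<comment> \<open>Only the lower bound \<open>c\<close> matters here; \<open>last x + 1\<close>
      merely fills the other slot.\<close>
    obtain a b where ab: "a \<in> feather" "b \<in> feather" "x \<in> feather_interval a b" "c < last a"
      using feather_interval_around[OF x, of "last x + 1"] by (metis less_add_one)
    moreover have "feather_interval a b \<subseteq> {x \<in> feather. c < last x}"
      using ab feather_less_last[OF ab(1)] less_trans unfolding feather_interval_def by blast
    ultimately show "\<exists>T. openin feather_topology T \<and> x \<in> T \<and> T \<subseteq> {x \<in> feather. c < last x}"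
      using openin_feather_interval by blast
  qed
  show "openin feather_topology {x \<in> feather. last x < c}"
  proof (subst openin_subopen, clarify)
    fix x :: "real list" assume x: "x \<in> feather" "last x < c"
    obtain a b where ab: "a \<in> feather" "b \<in> feather" "x \<in> feather_interval a b" "last b < c"
      using feather_interval_around[OF x(1) _ x(2), of "last x - 1"] by (metis diff_less_eq less_add_one)
    moreover have "feather_interval a b \<subseteq> {x \<in> feather. last x < c}"
      using ab feather_less_last[OF _ ab(2)] less_trans unfolding feather_interval_def by blast
    ultimately show "\<exists>T. openin feather_topology T \<and> x \<in> T \<and> T \<subseteq> {x \<in> feather. last x < c}"
      using openin_feather_interval by blast
  qed
qed

section \<open>Inseparable twins\<close>

lemma feather_less_append_replace:
  assumes "a \<in> feather" "feather_less a (v @ [l])" "last a < y"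
  shows "feather_less a (v @ [y])"
proof -
  obtain u k where a: "a = u @ [k]" using assms(1) by (rule feather_cases)
  then obtain m w where "v @ [l] = u @ m # w" "k < m"
    using assms(2) feather_less_append_iff by auto
  \<comment> \<open>If \<open>w\<close> is empty, then \<open>u = v\<close> and the claim is
    \<open>k < y\<close>; otherwise the comparison is decided inside \<open>v\<close> and ignores
    the final entry.\<close>
  then show ?thesis
    using a assms(3) by (cases w rule: rev_cases) (auto simp: feather_less_append_iff)
qed

text \<open>A point as long as \<open>v @ [l, l]\<close> and below it would be
  \<open>v @ [l, k]\<close> with \<open>k < l\<close>, which is not in \<open>feather\<close>. Hence
  the comparison is decided before the repeated entry.\<close>

lemma feather_less_twin:
  assumes "a \<in> feather" "feather_less a (v @ [l, l])"
  shows "feather_less a (v @ [l])"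
proof -
  obtain u k where a: "a = u @ [k]" "\<forall>x\<in>set u. x \<le> k"
    using assms(1) by (rule feather_cases)
  then obtain m w where t: "(v @ [l]) @ [l] = u @ m # w" "k < m"
    using assms(2) feather_less_append_iff by auto
  show ?thesis
  proof (cases w rule: rev_cases)
    case Nil
    then have "u = v @ [l]" "m = l" using t by auto
    then show ?thesis using a t by auto
  next
    case (snoc w' j)
    then have "v @ [l] = u @ m # w'" using t(1) by auto
    then show ?thesis using a t(2) by (auto simp: feather_less_append_iff)
  qed
qed

text \<open>Twins have the same points below them, so the points \<open>v @ [y]\<close> with
  \<open>y\<close> just below \<open>l\<close> approach both.\<close>

lemma feather_twins_inseparable:
  assumes v: "sorted_wrt (<) (v @ [l])"
    and U: "openin feather_topology U" "v @ [l] \<in> U"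
    and V: "openin feather_topology V" "v @ [l, l] \<in> V"
  shows "U \<inter> V \<noteq> {}"
proof -
  obtain a b where ab: "a \<in> feather" "v @ [l] \<in> feather_interval a b" "feather_interval a b \<subseteq> U"
    using U by (rule openin_feather_imp_interval)
  obtain c d where cd: "c \<in> feather" "v @ [l, l] \<in> feather_interval c d" "feather_interval c d \<subseteq> V"
    using V by (rule openin_feather_imp_interval)
  have a: "feather_less a (v @ [l])" and c: "feather_less c (v @ [l])"
    using ab cd feather_less_twin by (auto simp: feather_interval_def)
  have "v @ [l] \<in> feather" using ab by (simp add: feather_interval_def)
  then have "last a < l" "last c < l"
    using feather_less_last[OF ab(1) _ a] feather_less_last[OF cd(1) _ c] by auto
  \<comment> \<open>Exceeding \<open>last a\<close> and \<open>last c\<close> puts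
    \<open>v @ [y]\<close> above both lower endpoints; exceeding the entries of \<open>v\<close>
    keeps it in \<open>feather\<close>.\<close>
  then obtain y where y: "y < l" "last a < y" "last c < y" "\<forall>z\<in>set v. z < y"
    using dense_above_finite[of "insert (last a) (insert (last c) (set v))" l] v
    by (auto simp: sorted_wrt_append)
  have "v @ [y] \<in> feather"
    using v y by (auto simp: feather_append_iff sorted_wrt_append)
  moreover have "feather_less a (v @ [y])" "feather_less c (v @ [y])"
    using feather_less_append_replace ab(1) cd(1) a c y by auto
  \<comment> \<open>As \<open>y < l\<close>, the point \<open>v @ [y]\<close> lies below both twins,
    hence below their upper bounds.\<close>
  moreover have "feather_less (v @ [y]) b" "feather_less (v @ [y]) d"
    using ab(2) cd(2) y(1) \<open>v @ [y] \<in> feather\<close> feather_less_trans[of "v @ [y]"]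
    by (auto simp: feather_interval_def feather_less_append_iff)
  ultimately have "v @ [y] \<in> feather_interval a b" "v @ [y] \<in> feather_interval c d"
    by (auto simp: feather_interval_def)
  then show ?thesis using ab(3) cd(3) by blast
qed

lemma feather_exists_twin:
  assumes "p \<in> feather"
  obtains q where "q \<in> feather" "q \<noteq> p"
    "\<And>U V. \<lbrakk>openin feather_topology U; p \<in> U; openin feather_topology V; q \<in> V\<rbrakk> \<Longrightarrow> U \<inter> V \<noteq> {}"
proof -
  obtain v l where v: "sorted_wrt (<) (v @ [l])" and p: "p = v @ [l] \<or> p = v @ [l, l]"
    using assms by (rule feather_strict_cases)
  have "v @ [l] \<in> feather" "(v @ [l]) @ [l] \<in> feather"
    using v unfolding feather_append_iff by (auto simp: sorted_wrt_append less_imp_le)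
  then show thesis
    using p that[of "v @ [l]"] that[of "v @ [l, l]"] feather_twins_inseparable[OF v] by auto
qed

section \<open>Paths and homotopies\<close>

lemma feather_path_constant:
  assumes g: "continuous_map (top_of_set T) feather_topology g" and "connected T"
    and const: "\<And>t. t \<in> T \<Longrightarrow> last (g t) = r" and st: "s \<in> T" "t \<in> T"
  shows "g s = g t"
proof (rule connected_local_const[OF \<open>connected T\<close> st], rule ballI)
  fix a assume a: "a \<in> T"
  have gT: "g t \<in> feather" if "t \<in> T" for t
    using g that by (auto simp: continuous_map_def topspace_feather_topology)
  obtain c d where cd: "c \<in> feather" "d \<in> feather" "g a \<in> feather_interval c d"
    using feather_interval_around[OF gT[OF a], of "last (g a) - 1" "last (g a) + 1"]
    by (metis diff_less_eq less_add_one)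
  define S where "S = {t \<in> T. g t \<in> feather_interval c d}"
  have "openin (top_of_set T) S"
    using g openin_feather_interval[OF cd(1,2)] by (auto simp: continuous_map_def S_def)
  then have "\<forall>\<^sub>F t in at a within T. t \<in> S"
    using a cd(3) by (auto simp: S_def openin_open eventually_at_topological)
  \<comment> \<open>Near \<open>a\<close> the path stays below \<open>d\<close>, where equal last
    coordinates force equal points; connectedness of \<open>T\<close> turns local into global
    constancy.\<close>
  moreover have "g a = g t" if "t \<in> S" for t
    using that a cd(3) const feather_last_inj_below[of "g a" "g t" d]
    by (auto simp: S_def feather_interval_def)
  ultimately show "\<forall>\<^sub>F t in at a within T. g a = g t"
    by (rule eventually_mono)
qed

theorem lemma2p3:
  shows "\<not> (\<exists>p \<in> feather. strongly_contractible_to feather_topology p)"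
proof
  assume "\<exists>p \<in> feather. strongly_contractible_to feather_topology p"
  then obtain p h where p: "p \<in> feather"
    and h: "continuous_map (prod_topology feather_topology (top_of_set {0..1::real})) feather_topology h"
    and h0: "\<And>x. x \<in> feather \<Longrightarrow> h (x, 0) = x"
    and h1: "\<And>x. x \<in> feather \<Longrightarrow> h (x, 1) = p"
    and hp: "\<And>t. t \<in> {0..1} \<Longrightarrow> h (p, t) = p"
    unfolding strongly_contractible_to_def topspace_feather_topology by metis
  obtain q where q: "q \<in> feather" "q \<noteq> p"
    and insep: "\<And>U V. \<lbrakk>openin feather_topology U; p \<in> U; openin feather_topology V; q \<in> V\<rbrakk> \<Longrightarrow> U \<inter> V \<noteq> {}"
    using p by (rule feather_exists_twin) blast
  have path: "continuous_map (top_of_set {0..1}) feather_topology (\<lambda>t. h (q, t))"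
    by (rule continuous_map_compose[OF _ h, unfolded o_def])
      (use q in \<open>simp add: continuous_map_pairedI topspace_feather_topology\<close>)
  have "last (h (q, t)) = last p" if t: "t \<in> {0..1}" for t
  proof (rule ccontr)
    assume "last (h (q, t)) \<noteq> last p"
    \<comment> \<open>Disjoint neighbourhoods in the reals pull back along \<open>x\<close> to
      \<open>last (h (x, t))\<close>, with \<open>t\<close> fixed, to disjoint open sets around
      \<open>p\<close> and \<open>q\<close>; \<open>h (p, t) = p\<close> puts \<open>p\<close> in
      the first.\<close>
    then obtain A B where AB: "open A" "open B" "last p \<in> A" "last (h (q, t)) \<in> B" "A \<inter> B = {}"
      using hausdorff[of "last p"] by metis
    have "continuous_map feather_topology feather_topology (\<lambda>x. h (x, t))"
      by (rule continuous_map_compose[OF _ h, unfolded o_def])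
        (use t in \<open>simp add: continuous_map_pairedI\<close>)
    then have f: "continuous_map feather_topology euclideanreal (\<lambda>x. last (h (x, t)))"
      using continuous_map_compose[OF _ continuous_map_feather_last] by (simp add: o_def)
    have "openin feather_topology {x \<in> feather. last (h (x, t)) \<in> C}" if "open C" for C
      using openin_continuous_map_preimage[OF f] that by (simp add: topspace_feather_topology)
    then show False
      using insep[of "{x \<in> feather. last (h (x, t)) \<in> A}" "{x \<in> feather. last (h (x, t)) \<in> B}"]
        AB p q hp[OF t] by auto
  qed
  then have "h (q, 0) = h (q, 1)"
    by (intro feather_path_constant[OF path]) auto
  then show False
    using h0 h1 q by simp
qed

end
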